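(* Let $A,B,C$ be commutative rings with identity, let $\alpha: A\to C$ be a ring homomorphism and $\beta: B\to C$ a surjective ring homomorphism. Let $D=\{(a,b)\in A\times B\mid \alpha(a)=\beta(b)\}$ be the pullback of $\alpha$ and $\beta$, with projection $p_A:D\to A$, $(a,b)\mapsto a$. If $S$ is a multiplicative subset of $D$, then the following assertions are equivalent: (1) $D$ is a $u$-$S$-Noetherian ring; (2) $A$ is a $u$-$p_A(S)$-Noetherian ring and $\mathrm{Ker}(\beta)$ is a $u$-$S$-Noetherian $D$-module.
   Context: A subset $S$ of a ring is multiplicative if $1\in S$ and $s_1s_2\in S$ for all $s_1,s_2\in S$. Here $p_A(S)=\{p_A(s)\mid s\in S\}$, a multiplicative subset of $A$, and $\mathrm{Ker}(\beta)$ is a $D$-module via the projection $p_B:D\to B$, $(a,b)\mapsto b$. For a commutative ring $R$ with multiplicative subset $S$: an $R$-module $N$ is $u$-$S$-Noetherian if there exists $s\in S$ such that for every submodule $L$ of $N$ there is a finitely generated submodule $F\subseteq L$ with $sL\subseteq F$; the ring $R$ is $u$-$S$-Noetherian if it is so as an $R$-module. *)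

theory Defs
  imports "HOL-Algebra.Algebra"
begin

text \<open>Multiplicative subsets of a ring \<open>R\<close> are expressed by the library predicate
  \<open>submonoid S R\<close>, which refers to the multiplicative structure of \<open>R\<close>.\<close>

definition submodule_span :: "('a, 'm) ring_scheme \<Rightarrow> ('a, 'b, 'n) module_scheme \<Rightarrow> 'b set \<Rightarrow> 'b set"
  where "submodule_span R M G = \<Inter> {H. submodule H R M \<and> G \<subseteq> H}"

definition fg_submodule :: "'b set \<Rightarrow> ('a, 'm) ring_scheme \<Rightarrow> ('a, 'b, 'n) module_scheme \<Rightarrow> bool"
  where "fg_submodule F R M \<longleftrightarrow>
    submodule F R M \<and> (\<exists>G. finite G \<and> G \<subseteq> carrier M \<and> F = submodule_span R M G)"

text \<open>The element \<open>s\<close> is chosen uniformly, i.e. before the submodule \<open>L\<close>.\<close>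

definition u_S_Noetherian_module ::
  "('a, 'm) ring_scheme \<Rightarrow> 'a set \<Rightarrow> ('a, 'b, 'n) module_scheme \<Rightarrow> bool"
  where "u_S_Noetherian_module R S M \<longleftrightarrow>
    (\<exists>s\<in>S. \<forall>L. submodule L R M \<longrightarrow>
      (\<exists>F. fg_submodule F R M \<and> F \<subseteq> L \<and> (\<lambda>x. s \<odot>\<^bsub>M\<^esub> x) ` L \<subseteq> F))"

definition self_module :: "('a, 'm) ring_scheme \<Rightarrow> ('a, 'a) module"
  where "self_module R =
    \<lparr>carrier = carrier R, monoid.mult = monoid.mult R, monoid.one = monoid.one R, ring.zero = ring.zero R, ring.add = ring.add R,
     smult = monoid.mult R\<rparr>"

definition u_S_Noetherian_ring :: "('a, 'm) ring_scheme \<Rightarrow> 'a set \<Rightarrow> bool"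
  where "u_S_Noetherian_ring R S \<longleftrightarrow> u_S_Noetherian_module R S (self_module R)"

definition pullback_ring ::
  "('a, 'm) ring_scheme \<Rightarrow> ('b, 'n) ring_scheme \<Rightarrow> ('a \<Rightarrow> 'c) \<Rightarrow> ('b \<Rightarrow> 'c) \<Rightarrow> ('a \<times> 'b) ring"
  where "pullback_ring A B \<alpha> \<beta> =
    (RDirProd A B)\<lparr>carrier := {(a, b). a \<in> carrier A \<and> b \<in> carrier B \<and> \<alpha> a = \<beta> b}\<rparr>"

text \<open>The kernel of \<open>\<beta>\<close> as a module over the pullback, via the second projection.
  The module record extends the ring record, so \<open>mult\<close> and \<open>one\<close> must be filled in;
  they play no role in the module structure.\<close>

definition kernel_module ::
  "('b, 'n) ring_scheme \<Rightarrow> ('c, 'k) ring_scheme \<Rightarrow> ('b \<Rightarrow> 'c) \<Rightarrow> ('a \<times> 'b, 'b) module"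
  where "kernel_module B C \<beta> =
    \<lparr>carrier = a_kernel B C \<beta>, monoid.mult = monoid.mult B, monoid.one = monoid.one B, ring.zero = ring.zero B, ring.add = ring.add B,
     smult = (\<lambda>d x. snd d \<otimes>\<^bsub>B\<^esub> x)\<rparr>"

lemma pullback_ring_simps [simp]:
  "carrier (pullback_ring A B \<alpha> \<beta>) = {(a, b). a \<in> carrier A \<and> b \<in> carrier B \<and> \<alpha> a = \<beta> b}"
  "x \<otimes>\<^bsub>pullback_ring A B \<alpha> \<beta>\<^esub> y = (fst x \<otimes>\<^bsub>A\<^esub> fst y, snd x \<otimes>\<^bsub>B\<^esub> snd y)"
  "x \<oplus>\<^bsub>pullback_ring A B \<alpha> \<beta>\<^esub> y = (fst x \<oplus>\<^bsub>A\<^esub> fst y, snd x \<oplus>\<^bsub>B\<^esub> snd y)"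
  "\<one>\<^bsub>pullback_ring A B \<alpha> \<beta>\<^esub> = (\<one>\<^bsub>A\<^esub>, \<one>\<^bsub>B\<^esub>)"
  "\<zero>\<^bsub>pullback_ring A B \<alpha> \<beta>\<^esub> = (\<zero>\<^bsub>A\<^esub>, \<zero>\<^bsub>B\<^esub>)"
  by (simp_all add: pullback_ring_def RDirProd_def DirProd_def monoid.defs split: prod.splits)

lemma self_module_simps [simp]:
  "carrier (self_module R) = carrier R"
  "x \<oplus>\<^bsub>self_module R\<^esub> y = x \<oplus>\<^bsub>R\<^esub> y"
  "\<zero>\<^bsub>self_module R\<^esub> = \<zero>\<^bsub>R\<^esub>"
  "x \<odot>\<^bsub>self_module R\<^esub> y = x \<otimes>\<^bsub>R\<^esub> y"
  by (simp_all add: self_module_def)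

lemma kernel_module_simps [simp]:
  "carrier (kernel_module B C \<beta>) = {b \<in> carrier B. \<beta> b = \<zero>\<^bsub>C\<^esub>}"
  "x \<oplus>\<^bsub>kernel_module B C \<beta>\<^esub> y = x \<oplus>\<^bsub>B\<^esub> y"
  "\<zero>\<^bsub>kernel_module B C \<beta>\<^esub> = \<zero>\<^bsub>B\<^esub>"
  "d \<odot>\<^bsub>kernel_module B C \<beta>\<^esub> y = snd d \<otimes>\<^bsub>B\<^esub> y"
  by (simp_all add: kernel_module_def a_kernel_def kernel_def)

lemma self_module_module:
  assumes "cring R"
  shows "module R (self_module R)"
proof -
  interpret cring R by fact
  have "abelian_group (self_module R)"
  proof (rule abelian_groupI)
    fix x assume "x \<in> carrier (self_module R)"
    then show "\<exists>y\<in>carrier (self_module R). y \<oplus>\<^bsub>self_module R\<^esub> x = \<zero>\<^bsub>self_module R\<^esub>"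
      by (auto intro!: bexI[of _ "\<ominus>\<^bsub>R\<^esub> x"] l_neg)
  qed (auto simp: a_ac)
  with assms show ?thesis
    by (rule moduleI) (simp_all add: l_distr r_distr m_assoc)
qed

lemma pullback_ring_cring:
  assumes "cring A" "cring B" "cring C" "\<alpha> \<in> ring_hom A C" "\<beta> \<in> ring_hom B C"
  shows "cring (pullback_ring A B \<alpha> \<beta>)"
proof -
  interpret A: cring A by fact
  interpret B: cring B by fact
  interpret C: cring C by fact
  interpret \<alpha>: ring_hom_cring A C \<alpha>
    by (rule ring_hom_cring.intro) (use assms in \<open>auto intro!: ring_hom_cring_axioms.intro\<close>)
  interpret \<beta>: ring_hom_cring B C \<beta>
    by (rule ring_hom_cring.intro) (use assms in \<open>auto intro!: ring_hom_cring_axioms.intro\<close>)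
  let ?D = "pullback_ring A B \<alpha> \<beta>"
  have "abelian_group ?D"
  proof (rule abelian_groupI)
    fix x assume "x \<in> carrier ?D"
    then have "(\<ominus>\<^bsub>A\<^esub> fst x, \<ominus>\<^bsub>B\<^esub> snd x) \<in> carrier ?D"
      "(\<ominus>\<^bsub>A\<^esub> fst x, \<ominus>\<^bsub>B\<^esub> snd x) \<oplus>\<^bsub>?D\<^esub> x = \<zero>\<^bsub>?D\<^esub>"
      by (auto simp: A.l_neg B.l_neg)
    then show "\<exists>y\<in>carrier ?D. y \<oplus>\<^bsub>?D\<^esub> x = \<zero>\<^bsub>?D\<^esub>" by blast
  qed (auto simp: A.a_ac B.a_ac)
  moreover have "comm_monoid ?D"
    by (rule comm_monoidI) (auto simp: A.m_ac B.m_ac)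
  ultimately show ?thesis
    by (rule cringI) (auto simp: A.l_distr B.l_distr)
qed

lemma kernel_module_module:
  assumes "cring A" "cring B" "cring C" "\<alpha> \<in> ring_hom A C" "\<beta> \<in> ring_hom B C"
  shows "module (pullback_ring A B \<alpha> \<beta>) (kernel_module B C \<beta>)"
proof -
  interpret A: cring A by fact
  interpret B: cring B by fact
  interpret C: cring C by fact
  interpret \<beta>: ring_hom_cring B C \<beta>
    by (rule ring_hom_cring.intro) (use assms in \<open>auto intro!: ring_hom_cring_axioms.intro\<close>)
  let ?K = "kernel_module B C \<beta> :: ('a \<times> 'c, 'c) module"
  have "abelian_group ?K"
  proof (rule abelian_groupI)
    fix x assume "x \<in> carrier ?K"
    then have "\<ominus>\<^bsub>B\<^esub> x \<in> carrier ?K" "\<ominus>\<^bsub>B\<^esub> x \<oplus>\<^bsub>?K\<^esub> x = \<zero>\<^bsub>?K\<^esub>"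
      by (simp_all add: B.l_neg)
    then show "\<exists>y\<in>carrier ?K. y \<oplus>\<^bsub>?K\<^esub> x = \<zero>\<^bsub>?K\<^esub>" by blast
  qed (auto simp: B.a_ac)
  with pullback_ring_cring[OF assms] show ?thesis
    by (rule moduleI)
      (auto simp: B.l_distr B.r_distr B.m_assoc)
qed

lemma fst_image_submonoid:
  assumes "submonoid S (pullback_ring A B \<alpha> \<beta>)"
  shows "submonoid (fst ` S) A"
proof -
  interpret submonoid S "pullback_ring A B \<alpha> \<beta>" by fact
  show ?thesis
  proof
    show "fst ` S \<subseteq> carrier A" using subset by auto
    show "\<one>\<^bsub>A\<^esub> \<in> fst ` S" using one_closed by force
    show "x \<otimes>\<^bsub>A\<^esub> y \<in> fst ` S" if "x \<in> fst ` S" "y \<in> fst ` S" for x y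
      using that m_closed by (force simp: image_iff)
  qed
qed

lemma fg_submodule_span:
  assumes "module R M" "finite G" "G \<subseteq> carrier M"
  shows "fg_submodule (submodule_span R M G) R M"
proof -
  interpret module R M by fact
  have "carrier M \<in> {H. submodule H R M \<and> G \<subseteq> H}"
    using assms(3) carrier_is_submodule by simp
  then have "submodule (submodule_span R M G) R M"
    unfolding submodule_span_def
    by (intro submoduleI) (auto dest: submoduleE(3,4) subgroup.one_closed[OF submodule.axioms(1)]
        intro: submoduleE(5))
  with assms show ?thesis unfolding fg_submodule_def by blast
qed

end

theory Submission
  imports Defs
begin

text \<open>With \<open>D\<close> the pullback, the sequence \<open>0 \<rightarrow> Ker \<beta> \<rightarrow> D \<rightarrow> A \<rightarrow> 0\<close> is exact because
  \<open>\<beta>\<close> is surjective, and the uniform Noetherian property behaves well in short exact sequences: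
  it passes to submodules and quotients, and conversely, if \<open>s\<close> works for the quotient and
  \<open>t\<close> for the submodule, then \<open>s t\<close> works in the middle.  The right-hand term is a module over
  \<open>A\<close> rather than \<open>D\<close>, so the argument is carried out for semilinear maps.\<close>

lemma (in module) submodule_subset: "submodule H R M \<Longrightarrow> H \<subseteq> carrier M"
  by (metis submoduleE(1))

lemma (in module) submodule_zero: "submodule H R M \<Longrightarrow> \<zero>\<^bsub>M\<^esub> \<in> H"
  using subgroup.one_closed[OF submodule.axioms(1), of H R M] by simp

lemma (in module) submodule_span_submodule:
  assumes "G \<subseteq> carrier M"
  shows "submodule (submodule_span R M G) R M"
proof -
  \<comment> \<open>The whole module keeps the intersected family nonempty, so the intersection
    stays inside \<open>carrier M\<close>.\<close>
  have "carrier M \<in> {H. submodule H R M \<and> G \<subseteq> H}"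
    using assms carrier_is_submodule by simp
  then show ?thesis
    unfolding submodule_span_def
    by (intro submoduleI) (auto dest: submoduleE(3,4) submodule_zero intro: submoduleE(5))
qed

lemma submodule_span_superset: "G \<subseteq> submodule_span R M G"
  unfolding submodule_span_def by blast

lemma submodule_span_least: "submodule H R M \<Longrightarrow> G \<subseteq> H \<Longrightarrow> submodule_span R M G \<subseteq> H"
  unfolding submodule_span_def by blast

text \<open>A submodule \<open>L\<close> contains the span of \<open>G\<close> exactly when it
  contains \<open>G\<close>, so \<open>F\<close> may be traded for finitely many elements of
  \<open>L\<close>. Finite sets are easier to push forward and lift along maps.\<close>

lemma (in module) u_S_Noetherian_module_iff_span:
  "u_S_Noetherian_module R S M \<longleftrightarrow>
    (\<exists>s\<in>S. \<forall>L. submodule L R M \<longrightarrow>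
      (\<exists>G. finite G \<and> G \<subseteq> L \<and> (\<forall>x\<in>L. s \<odot>\<^bsub>M\<^esub> x \<in> submodule_span R M G)))"
proof -
  have "(\<exists>F. fg_submodule F R M \<and> F \<subseteq> L \<and> (\<lambda>x. s \<odot>\<^bsub>M\<^esub> x) ` L \<subseteq> F) \<longleftrightarrow>
      (\<exists>G. finite G \<and> G \<subseteq> L \<and> (\<forall>x\<in>L. s \<odot>\<^bsub>M\<^esub> x \<in> submodule_span R M G))" (is "?l \<longleftrightarrow> ?r")
    if L: "submodule L R M" for L s
  proof
    assume ?l
    then obtain G where G: "finite G" and sub: "submodule_span R M G \<subseteq> L"
      and im: "(\<lambda>x. s \<odot>\<^bsub>M\<^esub> x) ` L \<subseteq> submodule_span R M G"
      unfolding fg_submodule_def by auto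
    show ?r
    proof (intro exI conjI ballI)
      show "finite G" by fact
      show "G \<subseteq> L" using submodule_span_superset sub by (rule subset_trans)
      show "s \<odot>\<^bsub>M\<^esub> x \<in> submodule_span R M G" if "x \<in> L" for x
        using im imageI[OF that] by (rule subsetD)
    qed
  next
    assume ?r
    then obtain G where G: "finite G" "G \<subseteq> L"
      and im: "\<forall>x\<in>L. s \<odot>\<^bsub>M\<^esub> x \<in> submodule_span R M G" by auto
    show ?l
    proof (intro exI conjI)
      show "fg_submodule (submodule_span R M G) R M"
        using G submodule_subset[OF L] by (intro fg_submodule_span module_axioms) auto
      show "submodule_span R M G \<subseteq> L"
        using L G(2) by (rule submodule_span_least)
      show "(\<lambda>x. s \<odot>\<^bsub>M\<^esub> x) ` L \<subseteq> submodule_span R M G"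
        using im by (simp add: image_subset_iff)
    qed
  qed
  then show ?thesis unfolding u_S_Noetherian_module_def by (intro bex_cong all_cong refl)
qed

text \<open>Covers both maps of the exact sequence: the inclusion of the kernel, with identity
  scalars, and the projection from \<open>D\<close> to \<open>A\<close>, which changes the scalars.
  Making \<open>\<phi>\<close> onto ensures that every scalar of \<open>R'\<close> acts on an image
  through some scalar of \<open>R\<close>.\<close>

locale semilinear_map = M: module R M + N: module R' N
  for R :: "('r, 'p) ring_scheme" and M :: "('r, 'x, 'q) module_scheme"
    and R' :: "('s, 't) ring_scheme" and N :: "('s, 'y, 'u) module_scheme" +
  fixes \<phi> :: "'r \<Rightarrow> 's" and f :: "'x \<Rightarrow> 'y"
  assumes scalar_image: "\<phi> ` carrier R = carrier R'"
    and map_closed: "x \<in> carrier M \<Longrightarrow> f x \<in> carrier N"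
    and map_add: "x \<in> carrier M \<Longrightarrow> y \<in> carrier M \<Longrightarrow> f (x \<oplus>\<^bsub>M\<^esub> y) = f x \<oplus>\<^bsub>N\<^esub> f y"
    and map_smult: "r \<in> carrier R \<Longrightarrow> x \<in> carrier M \<Longrightarrow> f (r \<odot>\<^bsub>M\<^esub> x) = \<phi> r \<odot>\<^bsub>N\<^esub> f x"
begin

lemma scalar_closed: "r \<in> carrier R \<Longrightarrow> \<phi> r \<in> carrier R'"
  using scalar_image by blast

lemma group_hom_add: "group_hom (add_monoid M) (add_monoid N) f"
  by unfold_locales (auto simp: hom_def map_closed map_add)

lemma map_zero: "f \<zero>\<^bsub>M\<^esub> = \<zero>\<^bsub>N\<^esub>"
  using group_hom.hom_one[OF group_hom_add] by simp

lemma map_minus: "x \<in> carrier M \<Longrightarrow> f (\<ominus>\<^bsub>M\<^esub> x) = \<ominus>\<^bsub>N\<^esub> f x"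
  using group_hom.hom_inv[OF group_hom_add] by (simp add: a_inv_def)

lemma submodule_image:
  assumes H: "submodule H R M"
  shows "submodule (f ` H) R' N"
proof (intro N.submoduleI)
  note HM = subsetD[OF M.submodule_subset[OF H]]
  show "f ` H \<subseteq> carrier N" using HM map_closed by blast
  show "\<zero>\<^bsub>N\<^esub> \<in> f ` H" using M.submodule_zero[OF H] map_zero by force
  show "\<ominus>\<^bsub>N\<^esub> a \<in> f ` H" if "a \<in> f ` H" for a
    using that HM M.submoduleE(3)[OF H] by (auto simp: map_minus[symmetric])
  show "a \<oplus>\<^bsub>N\<^esub> b \<in> f ` H" if "a \<in> f ` H" "b \<in> f ` H" for a b
    using that HM M.submoduleE(5)[OF H] by (auto simp: map_add[symmetric])
  show "a \<odot>\<^bsub>N\<^esub> x \<in> f ` H" if "a \<in> carrier R'" "x \<in> f ` H" for a x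
    using that HM M.submoduleE(4)[OF H] by (auto simp: map_smult[symmetric] scalar_image[symmetric])
qed

lemma submodule_vimage:
  assumes H: "submodule H R' N"
  shows "submodule {x \<in> carrier M. f x \<in> H} R M"
proof (intro M.submoduleI)
  show "\<zero>\<^bsub>M\<^esub> \<in> {x \<in> carrier M. f x \<in> H}"
    using N.submodule_zero[OF H] map_zero by simp
qed (auto simp: map_minus map_add map_smult scalar_closed N.submoduleE(3-5)[OF H])

lemma span_image:
  assumes G: "G \<subseteq> carrier M"
  shows "f ` submodule_span R M G = submodule_span R' N (f ` G)"
proof
  have fG: "f ` G \<subseteq> carrier N" using G map_closed by blast
  have "submodule_span R M G \<subseteq> {x \<in> carrier M. f x \<in> submodule_span R' N (f ` G)}"
    using G submodule_span_superset[of "f ` G" R' N]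
    by (intro submodule_span_least submodule_vimage N.submodule_span_submodule fG) blast
  then show "f ` submodule_span R M G \<subseteq> submodule_span R' N (f ` G)" by blast
  show "submodule_span R' N (f ` G) \<subseteq> f ` submodule_span R M G"
    by (intro submodule_span_least submodule_image M.submodule_span_submodule G
        image_mono submodule_span_superset)
qed

text \<open>Generators for the preimage of \<open>L\<close> map to generators for \<open>L\<close>,
  and \<open>\<phi> s\<close> is uniform because \<open>s\<close> is.\<close>

lemma u_S_Noetherian_quotient:
  assumes surj: "f ` carrier M = carrier N"
    and S: "S \<subseteq> carrier R" and noeth: "u_S_Noetherian_module R S M"
  shows "u_S_Noetherian_module R' (\<phi> ` S) N"
proof -
  obtain s where s: "s \<in> S" and span: "\<And>L. submodule L R M \<Longrightarrow>
      \<exists>G. finite G \<and> G \<subseteq> L \<and> (\<forall>x\<in>L. s \<odot>\<^bsub>M\<^esub> x \<in> submodule_span R M G)"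
    using noeth unfolding M.u_S_Noetherian_module_iff_span by blast
  have "\<exists>G. finite G \<and> G \<subseteq> L \<and> (\<forall>y\<in>L. \<phi> s \<odot>\<^bsub>N\<^esub> y \<in> submodule_span R' N G)"
    if L: "submodule L R' N" for L
  proof -
    obtain G where G: "finite G" "G \<subseteq> {x \<in> carrier M. f x \<in> L}"
      and sG: "\<And>x. x \<in> carrier M \<Longrightarrow> f x \<in> L \<Longrightarrow> s \<odot>\<^bsub>M\<^esub> x \<in> submodule_span R M G"
      using span[OF submodule_vimage[OF L]] by blast
    have "\<phi> s \<odot>\<^bsub>N\<^esub> y \<in> submodule_span R' N (f ` G)" if "y \<in> L" for y
    proof -
      obtain x where x: "x \<in> carrier M" "y = f x"
        using surj N.submodule_subset[OF L] \<open>y \<in> L\<close> by blast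
      have "f (s \<odot>\<^bsub>M\<^esub> x) \<in> f ` submodule_span R M G"
        using sG x \<open>y \<in> L\<close> by (intro imageI) simp
      moreover have "f ` submodule_span R M G = submodule_span R' N (f ` G)"
        using G(2) by (intro span_image) blast
      moreover have "f (s \<odot>\<^bsub>M\<^esub> x) = \<phi> s \<odot>\<^bsub>N\<^esub> y"
        using x s S by (auto simp: map_smult)
      ultimately show ?thesis by simp
    qed
    moreover have "finite (f ` G)" "f ` G \<subseteq> L" using G by auto
    ultimately show ?thesis by metis
  qed
  with s show ?thesis unfolding N.u_S_Noetherian_module_iff_span by blast
qed

end

lemma u_S_Noetherian_submodule:
  assumes "semilinear_map R K R M (\<lambda>r. r) i" and inj: "inj_on i (carrier K)"
    and S: "S \<subseteq> carrier R" and noeth: "u_S_Noetherian_module R S M"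
  shows "u_S_Noetherian_module R S K"
proof -
  interpret semilinear_map R K R M "\<lambda>r. r" i by fact
  obtain s where s: "s \<in> S" and span: "\<And>L. submodule L R M \<Longrightarrow>
      \<exists>G. finite G \<and> G \<subseteq> L \<and> (\<forall>x\<in>L. s \<odot>\<^bsub>M\<^esub> x \<in> submodule_span R M G)"
    using noeth unfolding N.u_S_Noetherian_module_iff_span by blast
  have "\<exists>G. finite G \<and> G \<subseteq> L \<and> (\<forall>x\<in>L. s \<odot>\<^bsub>K\<^esub> x \<in> submodule_span R K G)"
    if L: "submodule L R K" for L
  proof -
    obtain G where G: "finite G" "G \<subseteq> L"
      and sG: "\<forall>y\<in>i ` L. s \<odot>\<^bsub>M\<^esub> y \<in> submodule_span R M (i ` G)"
      using span[OF submodule_image[OF L]] by (metis finite_subset_image)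
    have GK: "G \<subseteq> carrier K" using G(2) M.submodule_subset[OF L] by blast
    have "s \<odot>\<^bsub>K\<^esub> x \<in> submodule_span R K G" if "x \<in> L" for x
    proof -
      have xK: "x \<in> carrier K" and sR: "s \<in> carrier R"
        using \<open>x \<in> L\<close> M.submodule_subset[OF L] s S by auto
      then have "i (s \<odot>\<^bsub>K\<^esub> x) \<in> i ` submodule_span R K G"
        using sG \<open>x \<in> L\<close> span_image[OF GK] by (simp add: map_smult)
      then show ?thesis
        using inj_on_image_mem_iff[OF inj] M.smult_closed[OF sR xK]
          M.submodule_subset[OF M.submodule_span_submodule[OF GK]] by blast
    qed
    with G show ?thesis by blast
  qed
  with s show ?thesis unfolding M.u_S_Noetherian_module_iff_span by blast
qed

lemma u_S_Noetherian_extension: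
  assumes "semilinear_map R K R M (\<lambda>r. r) i" and "semilinear_map R M R' N \<phi> p"
    and exact: "\<And>x. x \<in> carrier M \<Longrightarrow> p x = \<zero>\<^bsub>N\<^esub> \<Longrightarrow> x \<in> i ` carrier K"
    and S: "submonoid S R"
    and noeth_K: "u_S_Noetherian_module R S K" and noeth_N: "u_S_Noetherian_module R' (\<phi> ` S) N"
  shows "u_S_Noetherian_module R S M"
proof -
  interpret i: semilinear_map R K R M "\<lambda>r. r" i by fact
  interpret p: semilinear_map R M R' N \<phi> p by fact
  interpret S: submonoid S R by fact
  obtain s where s: "s \<in> S" and span_N: "\<And>L. submodule L R' N \<Longrightarrow>
      \<exists>G. finite G \<and> G \<subseteq> L \<and> (\<forall>y\<in>L. \<phi> s \<odot>\<^bsub>N\<^esub> y \<in> submodule_span R' N G)"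
    using noeth_N unfolding p.N.u_S_Noetherian_module_iff_span by blast
  obtain t where t: "t \<in> S" and span_K: "\<And>L. submodule L R K \<Longrightarrow>
      \<exists>G. finite G \<and> G \<subseteq> L \<and> (\<forall>z\<in>L. t \<odot>\<^bsub>K\<^esub> z \<in> submodule_span R K G)"
    using noeth_K unfolding i.M.u_S_Noetherian_module_iff_span by blast
  have sR: "s \<in> carrier R" and tR: "t \<in> carrier R" using s t S.subset by auto
  have "\<exists>G. finite G \<and> G \<subseteq> L \<and> (\<forall>x\<in>L. (t \<otimes>\<^bsub>R\<^esub> s) \<odot>\<^bsub>M\<^esub> x \<in> submodule_span R M G)"
    if L: "submodule L R M" for L
  proof -
    note LM = i.N.submodule_subset[OF L]
    obtain G where G: "finite G" "G \<subseteq> L"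
      and sG: "\<forall>y\<in>p ` L. \<phi> s \<odot>\<^bsub>N\<^esub> y \<in> submodule_span R' N (p ` G)"
      using span_N[OF p.submodule_image[OF L]] by (metis finite_subset_image)
    obtain H where H: "finite H" "H \<subseteq> {z \<in> carrier K. i z \<in> L}"
      and tH: "\<forall>z\<in>{z \<in> carrier K. i z \<in> L}. t \<odot>\<^bsub>K\<^esub> z \<in> submodule_span R K H"
      using span_K[OF i.submodule_vimage[OF L]] by blast
    define F where "F = submodule_span R M (G \<union> i ` H)"
    have GH: "G \<union> i ` H \<subseteq> L" and GM: "G \<subseteq> carrier M" and HK: "H \<subseteq> carrier K"
      using G H LM by auto
    have F: "submodule F R M"
      unfolding F_def using GH LM by (intro i.N.submodule_span_submodule) blast
    have GF: "submodule_span R M G \<subseteq> F" and HF: "submodule_span R M (i ` H) \<subseteq> F"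
      using submodule_span_superset[of "G \<union> i ` H" R M]
      by (auto simp: F_def[symmetric] intro!: submodule_span_least[OF F])
    have FL: "F \<subseteq> L" unfolding F_def using L GH by (rule submodule_span_least)
    have "(t \<otimes>\<^bsub>R\<^esub> s) \<odot>\<^bsub>M\<^esub> x \<in> F" if x: "x \<in> L" for x
    proof -
      have xM: "x \<in> carrier M" using x LM by blast
      have "p (s \<odot>\<^bsub>M\<^esub> x) \<in> p ` submodule_span R M G"
        using sG x xM sR p.span_image[OF GM] by (simp add: p.map_smult)
      then obtain y where y: "y \<in> submodule_span R M G" and py: "p (s \<odot>\<^bsub>M\<^esub> x) = p y" by blast
      have yF: "y \<in> F" and yL: "y \<in> L" and yM: "y \<in> carrier M" using y GF FL LM by auto
      have sx: "s \<odot>\<^bsub>M\<^esub> x \<in> L" "s \<odot>\<^bsub>M\<^esub> x \<in> carrier M"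
        using i.N.submoduleE(4)[OF L sR x] LM by auto
      \<comment> \<open>The error term: \<open>s x\<close> and \<open>y\<close> have the same image
        under \<open>p\<close>, so \<open>d\<close> lies in the kernel of \<open>p\<close>, and it
        stays in \<open>L\<close>.\<close>
      define d where "d = s \<odot>\<^bsub>M\<^esub> x \<oplus>\<^bsub>M\<^esub> \<ominus>\<^bsub>M\<^esub> y"
      have dL: "d \<in> L"
        unfolding d_def using sx yL by (intro i.N.submoduleE(3,5)[OF L]) auto
      then have dM: "d \<in> carrier M" using LM by blast
      have "p d = \<zero>\<^bsub>N\<^esub>"
        using sx yM py by (simp add: d_def p.map_add p.map_minus p.map_closed p.N.r_neg)
      then obtain z where z: "z \<in> carrier K" "d = i z" using exact dM by blast
      then have "i (t \<odot>\<^bsub>K\<^esub> z) \<in> i ` submodule_span R K H" using tH dL by blast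
      then have td: "t \<odot>\<^bsub>M\<^esub> d \<in> F"
        using HF i.span_image[OF HK] z tR by (auto simp: i.map_smult)
      \<comment> \<open>Multiplying this decomposition by \<open>t\<close> puts both summands into
        \<open>F\<close>.\<close>
      have "s \<odot>\<^bsub>M\<^esub> x = d \<oplus>\<^bsub>M\<^esub> y"
        using sx yM by (simp add: d_def i.N.a_assoc i.N.l_neg)
      then have "(t \<otimes>\<^bsub>R\<^esub> s) \<odot>\<^bsub>M\<^esub> x = t \<odot>\<^bsub>M\<^esub> d \<oplus>\<^bsub>M\<^esub> t \<odot>\<^bsub>M\<^esub> y"
        using sR tR xM dM yM by (simp add: i.N.smult_assoc1 i.N.smult_r_distr)
      then show ?thesis
        using td yF tR i.N.submoduleE(4,5)[OF F] by simp
    qed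
    then show ?thesis
      using G(1) H(1) GH unfolding F_def by (intro exI[of _ "G \<union> i ` H"]) blast
  qed
  moreover have "t \<otimes>\<^bsub>R\<^esub> s \<in> S" using s t by simp
  ultimately show ?thesis unfolding i.N.u_S_Noetherian_module_iff_span by blast
qed

theorem proposition3p2:
  fixes A :: "('a, 'm) ring_scheme" and B :: "('b, 'n) ring_scheme" and C :: "('c, 'k) ring_scheme"
    and \<alpha> :: "'a \<Rightarrow> 'c" and \<beta> :: "'b \<Rightarrow> 'c" and S :: "('a \<times> 'b) set"
  assumes "cring A" and "cring B" and "cring C"
    and "\<alpha> \<in> ring_hom A C"
    and "\<beta> \<in> ring_hom B C" and "\<beta> ` carrier B = carrier C"
    and "submonoid S (pullback_ring A B \<alpha> \<beta>)"
  shows "u_S_Noetherian_ring (pullback_ring A B \<alpha> \<beta>) S \<longleftrightarrow>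
    u_S_Noetherian_ring A (fst ` S) \<and>
    u_S_Noetherian_module (pullback_ring A B \<alpha> \<beta>) S (kernel_module B C \<beta>)"
proof -
  interpret A: cring A by fact
  interpret \<alpha>: ring_hom_cring A C \<alpha>
    by (rule ring_hom_cring.intro) (use assms in \<open>auto intro!: ring_hom_cring_axioms.intro\<close>)
  let ?D = "pullback_ring A B \<alpha> \<beta>" and ?K = "kernel_module B C \<beta> :: ('a \<times> 'b, 'b) module"
  \<comment> \<open>For \<open>b\<close> in the kernel, \<open>(0, b)\<close> lies in the pullback
    since \<alpha> sends 0 to 0. The map is linear because \<open>D\<close> acts on the kernel
    through the second coordinate.\<close>
  let ?i = "\<lambda>b. (\<zero>\<^bsub>A\<^esub>, b)"
  have D: "cring ?D" and K: "module ?D ?K"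
    using assms by (auto intro: pullback_ring_cring kernel_module_module)
  \<comment> \<open>This is where surjectivity of \<beta> enters: it supplies a second coordinate
    over each \<open>a\<close>.\<close>
  have fst_surj: "fst ` carrier ?D = carrier A"
  proof -
    have "\<exists>b\<in>carrier B. \<alpha> a = \<beta> b" if "a \<in> carrier A" for a
      using assms(6) \<alpha>.hom_closed[OF that] by (metis imageE)
    then show ?thesis by (force simp: image_iff)
  qed
  have i: "semilinear_map ?D ?K ?D (self_module ?D) (\<lambda>r. r) ?i"
    using D K by (auto intro!: semilinear_map.intro self_module_module semilinear_map_axioms.intro)
  \<comment> \<open>\<open>fst\<close> serves both as the change of scalars and as the map of
    modules.\<close>
  have p: "semilinear_map ?D (self_module ?D) A (self_module A) fst fst"
    using D \<open>cring A\<close> fst_surj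
    by (intro semilinear_map.intro self_module_module semilinear_map_axioms.intro) auto
  \<comment> \<open>A pair \<open>(0, b)\<close> in the pullback satisfies \<beta> b = \<alpha> 0 =
    0.\<close>
  have exact: "x \<in> ?i ` carrier ?K" if "x \<in> carrier (self_module ?D)" "fst x = \<zero>\<^bsub>self_module A\<^esub>" for x
    using that by (cases x) auto
  have S: "S \<subseteq> carrier ?D" using assms(7) by (rule submonoid.subset)
  \<comment> \<open>The submodule and quotient lemmas give the forward direction, the extension
    lemma the converse.\<close>
  show ?thesis
    unfolding u_S_Noetherian_ring_def
    using u_S_Noetherian_submodule[OF i _ S]
      semilinear_map.u_S_Noetherian_quotient[OF p _ S]
      u_S_Noetherian_extension[OF i p exact assms(7)] fst_surj
    by (auto simp: inj_on_def)
qed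

end
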